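(* Let $d\ge1$ be an integer and take any $m\in\{0,1,2,\dots\}$. Then $$\inf_{L\in\mathcal L_{\mathsf{rand}}}\ \sup_D\mathfrak R_m(L,D)=\sup_D\mathfrak R_m(L^*_{\mathsf{ERM}},D)=B(m,d):=\sup_{p,\beta}\ \sum_{x=1}^d p_x\,|\beta_x|\,\mathsf E\operatorname{bayes}(N^p_x,|\beta_x|),$$ where $\sup_D$ is over all probability distributions $D$ on $[d]\times\{-1,1\}$, $\sup_{p,\beta}$ is over all pairs of functions $p\in[0,1]^{[d]}$ with $\sum_{x=1}^dp_x=1$ and $\beta\in[-1,1]^{[d]}$, and $N^p_x$ is a random variable with the binomial distribution with parameters $m$ and $p_x$. Moreover, for each such pair $(p,\beta)$, $$\mathfrak R_m(L^*_{\mathsf{ERM}},D_{p,\beta})=\sum_{x=1}^d p_x\,|\beta_x|\,\mathsf E\operatorname{bayes}(N^p_x,|\beta_x|),$$ which does not depend on the signs of $\beta_1,\dots,\beta_d$.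
   Context: Setting: $\mathcal X=[d]=\{1,\dots,d\}$, $\mathcal Y=\{-1,1\}$, $\mathcal H=\mathcal Y^{\mathcal X}$ (all functions $[d]\to\{-1,1\}$). For a probability distribution $D$ on $\mathcal X\times\mathcal Y$, $(X^D,Y^D)$ is a random pair with distribution $D$, and $Z_m^D=\big((X_1^D,Y_1^D),\dots,(X_m^D,Y_m^D)\big)$ consists of $m$ independent copies of it. Put $\operatorname{err}(h,D)=\mathsf P(h(X^D)\ne Y^D)$ and $\Delta(h,D)=\operatorname{err}(h,D)-\min_{g\in\mathcal H}\operatorname{err}(g,D)$. A randomized learning algorithm is a map $L\colon(\mathcal X\times\mathcal Y)^m\times[-1,1]\to\mathcal H$ (measurable in the last argument); $\mathcal L_{\mathsf{rand}}$ is the set of all of them. The expected excess risk is $\mathfrak R_m(L,D):=\mathsf E\,\Delta\big(L(Z_m^D,U),D\big)$, where $U$ is uniformly distributed on $[-1,1]$ and independent of $Z_m^D$. $D_{p,\beta}$ is the distribution on $[d]\times\{-1,1\}$ with $D_{p,\beta}(\{(x,y)\})=p_x\big(\frac12+\frac{y\beta_x}2\big)$. Let $\operatorname{sgn}u:=1$ if $u\ge0$ and $:=-1$ if $u<0$. For $z_m=\big((x_1,y_1),\dots,(x_m,y_m)\big)$ and $x\in[d]$ let $v_x:=\sum_{i=1}^m y_i\operatorname{I}\{x_i=x\}$, $n_x:=\sum_{i=1}^m\operatorname{I}\{x_i=x\}$, and (if $n_x\ne0$) $i_x:=\min\{i\in[m]\colon x_i=x\}$, where $\operatorname{I}$ is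 the indicator. The algorithm $L^*_{\mathsf{ERM}}\in\mathcal L_{\mathsf{rand}}$ is defined by: $L^*_{\mathsf{ERM}}(z_m,u)(x):=\operatorname{sgn}v_x$ if $v_x\ne0$; $:=y_{i_x}$ if $v_x=0$ but $n_x\ne0$; $:=\operatorname{sgn}u$ if $n_x=0$. For $k\in\{0,1,\dots\}$ and $b\in[-1,1]$: $V^b_k:=Y^b_1+\dots+Y^b_k$, where the $Y^b_i$ are iid with $\mathsf P(Y^b_i=1)=\frac{1+b}2$, $\mathsf P(Y^b_i=-1)=\frac{1-b}2$ (so $V^b_0=0$); $s_k(b):=|\mathsf P(V^b_k>0)-\mathsf P(V^{-b}_k>0)|$; $\operatorname{bayes}(k,b):=\frac12\big(1-s_k(b)\big)$. *)

theory Defs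
  imports "HOL-Probability.Probability"
begin

text \<open>
  Functions on \<open>[d] = {1..d}\<close> and samples of size \<open>m\<close> are extensional functions
  (\<open>\<rightarrow>\<^sub>E\<close>), so that each of the spaces below contains every mathematical function exactly once.
\<close>

definition examples :: "nat \<Rightarrow> (nat \<times> int) set" where
  "examples d = {1..d} \<times> {-1, 1}"

definition hypotheses :: "nat \<Rightarrow> (nat \<Rightarrow> int) set" where
  "hypotheses d = {1..d} \<rightarrow>\<^sub>E {-1, 1}"

definition samples :: "nat \<Rightarrow> nat \<Rightarrow> (nat \<Rightarrow> nat \<times> int) set" where
  "samples d m = {1..m} \<rightarrow>\<^sub>E examples d"

definition distributions :: "nat \<Rightarrow> (nat \<times> int) measure set" where
  "distributions d = {D. prob_space D \<and> sets D = Pow (examples d)}"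

definition err :: "(nat \<Rightarrow> int) \<Rightarrow> (nat \<times> int) measure \<Rightarrow> real" where
  "err h D = measure D {(x, y) \<in> space D. h x \<noteq> y}"

definition excess_risk :: "nat \<Rightarrow> (nat \<Rightarrow> int) \<Rightarrow> (nat \<times> int) measure \<Rightarrow> real" where
  "excess_risk d h D = err h D - Min ((\<lambda>g. err g D) ` hypotheses d)"

text \<open>
  The law of \<open>U\<close>. Its underlying space is the interval itself, since a learning algorithm is
  only constrained for seeds in \<open>[-1, 1]\<close>.
\<close>

definition seed :: "real measure" where
  "seed = uniform_measure (restrict_space lborel {-1..1}) {-1..1}"

definition rand_algs :: "nat \<Rightarrow> nat \<Rightarrow> ((nat \<Rightarrow> nat \<times> int) \<Rightarrow> real \<Rightarrow> nat \<Rightarrow> int) set" where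
  "rand_algs d m =
     {L. \<forall>z\<in>samples d m. L z \<in> restrict_space borel {-1..1} \<rightarrow>\<^sub>M count_space (hypotheses d)}"

text \<open>
  The product measure is the joint law of \<open>(Z, U)\<close>, where \<open>Z\<close> consists of \<open>m\<close> independent
  copies of a pair with law \<open>D\<close>, and \<open>U\<close> is independent of \<open>Z\<close>.
\<close>

definition risk ::
  "nat \<Rightarrow> nat \<Rightarrow> ((nat \<Rightarrow> nat \<times> int) \<Rightarrow> real \<Rightarrow> nat \<Rightarrow> int) \<Rightarrow> (nat \<times> int) measure \<Rightarrow> real" where
  "risk d m L D =
     (\<integral>(z, u). excess_risk d (L z u) D \<partial>((\<Pi>\<^sub>M i\<in>{1..m}. D) \<Otimes>\<^sub>M seed))"

definition params :: "nat \<Rightarrow> ((nat \<Rightarrow> real) \<times> (nat \<Rightarrow> real)) set" where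
  "params d =
     {(p, \<beta>). p \<in> {1..d} \<rightarrow>\<^sub>E {0..1} \<and> (\<Sum>x=1..d. p x) = 1 \<and> \<beta> \<in> {1..d} \<rightarrow>\<^sub>E {-1..1}}"

definition dist_of :: "nat \<Rightarrow> (nat \<Rightarrow> real) \<Rightarrow> (nat \<Rightarrow> real) \<Rightarrow> (nat \<times> int) measure" where
  "dist_of d p \<beta> =
     point_measure (examples d) (\<lambda>(x, y). ennreal (p x * (1 / 2 + of_int y * \<beta> x / 2)))"

text \<open>Unlike \<^const>\<open>sgn\<close>, this takes the value 1 at 0.\<close>

definition sgn1 :: "'a::linordered_idom \<Rightarrow> int" where
  "sgn1 u = (if u \<ge> 0 then 1 else -1)"

definition vote :: "nat \<Rightarrow> (nat \<Rightarrow> nat \<times> int) \<Rightarrow> nat \<Rightarrow> int" where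
  "vote m z x = (\<Sum>i=1..m. snd (z i) * of_bool (fst (z i) = x))"

definition occ :: "nat \<Rightarrow> (nat \<Rightarrow> nat \<times> int) \<Rightarrow> nat \<Rightarrow> nat" where
  "occ m z x = (\<Sum>i=1..m. of_bool (fst (z i) = x))"

definition first_occ :: "nat \<Rightarrow> (nat \<Rightarrow> nat \<times> int) \<Rightarrow> nat \<Rightarrow> nat" where
  "first_occ m z x = Min {i \<in> {1..m}. fst (z i) = x}"

definition L_ERM :: "nat \<Rightarrow> nat \<Rightarrow> (nat \<Rightarrow> nat \<times> int) \<Rightarrow> real \<Rightarrow> nat \<Rightarrow> int" where
  "L_ERM d m z u = (\<lambda>x\<in>{1..d}.
     if vote m z x \<noteq> 0 then sgn1 (vote m z x)
     else if occ m z x \<noteq> 0 then snd (z (first_occ m z x))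
     else sgn1 u)"

definition sign_pmf :: "real \<Rightarrow> int pmf" where
  "sign_pmf b = map_pmf (\<lambda>c. if c then 1 else -1) (bernoulli_pmf ((1 + b) / 2))"

text \<open>The law of \<open>V\<close>, the sum of \<open>k\<close> independent signs; 0 is the default value outside \<open>{1..k}\<close>.\<close>

definition walk_pmf :: "nat \<Rightarrow> real \<Rightarrow> int pmf" where
  "walk_pmf k b = map_pmf (\<lambda>Y. \<Sum>i=1..k. Y i) (Pi_pmf {1..k} 0 (\<lambda>_. sign_pmf b))"

definition sep :: "nat \<Rightarrow> real \<Rightarrow> real" where
  "sep k b = \<bar>measure_pmf.prob (walk_pmf k b) {v. v > 0}
             - measure_pmf.prob (walk_pmf k (- b)) {v. v > 0}\<bar>"

definition bayes :: "nat \<Rightarrow> real \<Rightarrow> real" where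
  "bayes k b = (1 - sep k b) / 2"

definition bayes_sum :: "nat \<Rightarrow> nat \<Rightarrow> (nat \<Rightarrow> real) \<Rightarrow> (nat \<Rightarrow> real) \<Rightarrow> real" where
  "bayes_sum m d p \<beta> =
     (\<Sum>x=1..d. p x * \<bar>\<beta> x\<bar> *
        measure_pmf.expectation (binomial_pmf m (p x)) (\<lambda>k. bayes k \<bar>\<beta> x\<bar>))"

definition B :: "nat \<Rightarrow> nat \<Rightarrow> real" where
  "B m d = (SUP (p, \<beta>)\<in>params d. bayes_sum m d p \<beta>)"

lemma L_ERM_rand_algs: "L_ERM d m \<in> rand_algs d m"
proof -
  have H: "L_ERM d m z u \<in> hypotheses d" if z: "z \<in> samples d m" for z u
  proof -
    have "snd (z (first_occ m z x)) \<in> {-1, 1}" if "occ m z x \<noteq> 0" for x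
    proof -
      have "{i \<in> {1..m}. fst (z i) = x} \<noteq> {}"
        using that by (auto simp: occ_def)
      then have "first_occ m z x \<in> {1..m}"
        using Min_in[of "{i \<in> {1..m}. fst (z i) = x}"] by (auto simp: first_occ_def)
      then have "z (first_occ m z x) \<in> examples d"
        using z unfolding samples_def by (rule PiE_mem[rotated])
      then show ?thesis by (auto simp: examples_def)
    qed
    then show ?thesis by (auto simp: L_ERM_def hypotheses_def sgn1_def)
  qed
  have fin: "finite (hypotheses d)" by (simp add: hypotheses_def finite_PiE)
  have "L_ERM d m z \<in> borel \<rightarrow>\<^sub>M count_space (hypotheses d)" if z: "z \<in> samples d m" for z
  proof -
    have "L_ERM d m z = (\<lambda>u. if 0 \<le> u then L_ERM d m z 0 else L_ERM d m z (- 1))"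
      by (auto simp: L_ERM_def sgn1_def fun_eq_iff)
    moreover have "\<dots> \<in> borel \<rightarrow>\<^sub>M count_space (hypotheses d)"
      using H[OF z] by (intro measurable_If) auto
    ultimately show ?thesis by simp
  qed
  then show ?thesis by (auto simp: rand_algs_def intro: measurable_restrict_space1)
qed

lemma dist_of_distributions:
  assumes "(p, \<beta>) \<in> params d"
  shows "dist_of d p \<beta> \<in> distributions d"
proof -
  have p: "0 \<le> p x" "-1 \<le> \<beta> x" "\<beta> x \<le> 1" if "x \<in> {1..d}" for x
    using assms PiE_mem[of p "{1..d}" "\<lambda>_. {0..1}" x] PiE_mem[of \<beta> "{1..d}" "\<lambda>_. {-1..1}" x] that
    by (auto simp: params_def)
  have nn: "0 \<le> p x * (1 / 2 + of_int y * \<beta> x / 2)" if "(x, y) \<in> examples d" for x y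
    using that p[of x] by (auto simp: examples_def intro!: mult_nonneg_nonneg)
  have "(\<Sum>(x, y)\<in>examples d. p x * (1 / 2 + of_int y * \<beta> x / 2)) = (\<Sum>x=1..d. p x)"
    unfolding examples_def by (subst sum.cartesian_product[symmetric]) (simp add: field_simps)
  then have "(\<Sum>(x, y)\<in>examples d. p x * (1 / 2 + of_int y * \<beta> x / 2)) = 1"
    using assms by (simp add: params_def)
  then have "(\<Sum>w\<in>examples d. ennreal (case w of (x, y) \<Rightarrow> p x * (1 / 2 + of_int y * \<beta> x / 2))) = 1"
    using nn by (subst sum_ennreal) auto
  then have "(\<Sum>w\<in>examples d. case w of (x, y) \<Rightarrow> ennreal (p x * (1 / 2 + of_int y * \<beta> x / 2))) = 1"
    by (simp add: case_prod_unfold)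
  then have "prob_space (dist_of d p \<beta>)"
    unfolding dist_of_def by (intro prob_space_point_measure) (auto simp: examples_def)
  then show ?thesis by (simp add: distributions_def dist_of_def sets_point_measure)
qed

text \<open>
  All quantities whose supremum or infimum is taken lie in \<open>[0, 1]\<close>, so those taken in
  \<^typ>\<open>real\<close> are the genuine ones.
\<close>

lemma prob_space_seed: "prob_space seed"
  unfolding seed_def
  by (rule prob_space_uniform_measure) (auto simp: emeasure_restrict_space)

lemma risk_bounds:
  assumes "L \<in> rand_algs d m" "D \<in> distributions d"
  shows "0 \<le> risk d m L D" "risk d m L D \<le> 1"
proof -
  interpret D: prob_space D using assms(2) by (simp add: distributions_def)
  interpret S: prob_space seed by (rule prob_space_seed)
  interpret P: product_prob_space "\<lambda>_. D" "{1..m}" by unfold_locales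
  interpret PP: pair_prob_space "\<Pi>\<^sub>M i\<in>{1..m}. D" seed by unfold_locales
  let ?M = "(\<Pi>\<^sub>M i\<in>{1..m}. D) \<Otimes>\<^sub>M seed"
  have fin: "finite (hypotheses d)" by (simp add: hypotheses_def finite_PiE)
  have ne: "hypotheses d \<noteq> {}" by (simp add: hypotheses_def PiE_eq_empty_iff)
  have spD: "space D = examples d"
    using assms(2) by (auto simp: distributions_def dest: sets_eq_imp_space_eq[of D "count_space (examples d)", simplified])
  have ex: "0 \<le> excess_risk d (L z u) D \<and> excess_risk d (L z u) D \<le> 1"
    if "z \<in> space (\<Pi>\<^sub>M i\<in>{1..m}. D)" "u \<in> space seed" for z u
  proof -
    have "z \<in> samples d m" using that(1) by (simp add: space_PiM samples_def spD)
    moreover have "u \<in> {-1..1}" using that(2) by (simp add: seed_def space_restrict_space)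
    ultimately have "L z u \<in> hypotheses d"
      using assms(1) measurable_space[of "L z" "restrict_space borel {-1..1}" "count_space (hypotheses d)" u]
      by (simp add: rand_algs_def space_restrict_space)
    then have "Min ((\<lambda>g. err g D) ` hypotheses d) \<le> err (L z u) D"
      using fin by (intro Min_le) auto
    moreover have "0 \<le> Min ((\<lambda>g. err g D) ` hypotheses d)"
      using fin ne by (auto simp: err_def)
    moreover have "err (L z u) D \<le> 1" by (simp add: err_def)
    ultimately show ?thesis by (simp add: excess_risk_def)
  qed
  show "0 \<le> risk d m L D"
    unfolding risk_def by (rule Bochner_Integration.integral_nonneg_AE, rule AE_I2) (auto simp: space_pair_measure ex)
  show "risk d m L D \<le> 1"
  proof (cases "integrable ?M (\<lambda>(z, u). excess_risk d (L z u) D)")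
    case True
    then show ?thesis unfolding risk_def
      by (rule PP.integral_le_const) (auto intro!: AE_I2 simp: space_pair_measure ex)
  qed (simp add: risk_def not_integrable_integral_eq)
qed

lemma bayes_sum_bounds:
  assumes "(p, \<beta>) \<in> params d"
  shows "0 \<le> bayes_sum m d p \<beta>" "bayes_sum m d p \<beta> \<le> 1"
proof -
  have p: "0 \<le> p x" "\<bar>\<beta> x\<bar> \<le> 1" if "x \<in> {1..d}" for x
    using assms PiE_mem[of p "{1..d}" "\<lambda>_. {0..1}" x] PiE_mem[of \<beta> "{1..d}" "\<lambda>_. {-1..1}" x] that
    by (auto simp: params_def)
  have "\<bar>s - t\<bar> \<le> 1" if "0 \<le> s" "s \<le> 1" "0 \<le> t" "t \<le> 1" for s t :: real
    using that by linarith
  then have "sep k c \<le> 1" for k c by (simp add: sep_def)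
  moreover have "0 \<le> sep k c" for k c by (simp add: sep_def)
  ultimately have b: "0 \<le> bayes k c \<and> bayes k c \<le> 1" for k c
    by (auto simp: bayes_def field_simps add_increasing2)
  have int: "integrable (measure_pmf M) (\<lambda>k. bayes k c)" for M c
    using b by (intro measure_pmf.integrable_const_bound[where B = 1]) (auto simp: abs_le_iff)
  have E: "0 \<le> measure_pmf.expectation M (\<lambda>k. bayes k c)"
    "measure_pmf.expectation M (\<lambda>k. bayes k c) \<le> 1" for M c
    using b int by (auto intro!: measure_pmf.integral_le_const Bochner_Integration.integral_nonneg)
  show "0 \<le> bayes_sum m d p \<beta>"
    unfolding bayes_sum_def using p E by (intro sum_nonneg mult_nonneg_nonneg) auto
  have "bayes_sum m d p \<beta> \<le> (\<Sum>x=1..d. p x * 1 * 1)"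
    unfolding bayes_sum_def using p E by (intro sum_mono mult_mono mult_nonneg_nonneg) auto
  then show "bayes_sum m d p \<beta> \<le> 1" using assms by (simp add: params_def)
qed

end

theory Submission
  imports Defs
begin

text \<open>
  For fixed \<open>(p, \<beta>)\<close>, average the risk of an algorithm over all \<open>D\<^bsub>p,\<gamma>\<^esub>\<close> with
  \<open>\<bar>\<gamma>\<bar> = \<bar>\<beta>\<bar>\<close>. Pairing \<open>\<gamma>\<close> with the function obtained by reversing the sign of \<open>\<gamma>\<^sub>x\<close>, the
  likelihoods of a sample under the two differ by a quantity with the sign of
  \<open>\<gamma>\<^sub>x v\<^sub>x\<close>; hence predicting \<open>sgn v\<^sub>x\<close> is optimal for the average, sample by sample, and
  the prediction is irrelevant when \<open>v\<^sub>x = 0\<close>. Since the risk of \<open>L\<^sup>*\<close> does not depend on the signs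
  of \<open>\<gamma>\<close>, no algorithm has a smaller worst-case risk. The formula for this risk follows
  because \<open>v\<^sub>x\<close> is a walk with a binomial number of steps.
\<close>

section \<open>Biased random walks\<close>

lemma walk_pmf_0: "walk_pmf 0 b = return_pmf 0"
  by (simp add: walk_pmf_def)

text \<open>Conditioning on the last sign. With the Bernoulli variable outermost, an expectation
  splits into two shifted expectations for the shorter walk.\<close>

lemma walk_pmf_Suc:
  "walk_pmf (Suc k) b =
     bernoulli_pmf ((1 + b) / 2) \<bind> (\<lambda>c. map_pmf ((+) (if c then 1 else - 1)) (walk_pmf k b))"
proof -
  have "{1..Suc k} = insert (Suc k) {1..k}" by auto
  moreover have "(\<Sum>i=1..k. (Y(Suc k := s)) i) = (\<Sum>i=1..k. Y i)" for Y :: "nat \<Rightarrow> int" and s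
    by (intro sum.cong) auto
  ultimately show ?thesis
    by (simp add: walk_pmf_def Pi_pmf_insert' map_bind_pmf sign_pmf_def bind_map_pmf map_pmf_comp)
       (simp add: map_pmf_def bind_assoc_pmf bind_return_pmf)
qed

lemma finite_set_pmf_walk: "finite (set_pmf (walk_pmf k b))"
  by (induction k) (auto simp: walk_pmf_0 walk_pmf_Suc)

text \<open>The bound on \<open>b\<close> makes \<open>(1 + b) / 2\<close> a probability, so that
  \<open>bernoulli_pmf\<close> does not clip its parameter.\<close>

lemma expectation_walk_pmf_Suc:
  fixes F :: "int \<Rightarrow> real"
  assumes "\<bar>b\<bar> \<le> 1"
  shows "measure_pmf.expectation (walk_pmf (Suc k) b) F =
     (1 + b) / 2 * measure_pmf.expectation (walk_pmf k b) (\<lambda>v. F (1 + v)) +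
     (1 - b) / 2 * measure_pmf.expectation (walk_pmf k b) (\<lambda>v. F (- 1 + v))"
  unfolding walk_pmf_Suc using assms
  by (subst pmf_expectation_bind[of UNIV]) (auto simp: finite_set_pmf_walk UNIV_bool field_simps)

text \<open>Conditioning on one trial. The recursion for the vote has this shape, an example hitting
  \<open>x\<close> with probability \<open>p x\<close>.\<close>

lemma expectation_binomial_pmf_Suc:
  fixes h :: "nat \<Rightarrow> real"
  assumes "p \<in> {0..1}"
  shows "measure_pmf.expectation (binomial_pmf (Suc m) p) h =
     p * measure_pmf.expectation (binomial_pmf m p) (\<lambda>k. h (Suc k)) +
     (1 - p) * measure_pmf.expectation (binomial_pmf m p) h"
proof -
  have "binomial_pmf (Suc m) p =
      bernoulli_pmf p \<bind> (\<lambda>c. map_pmf ((+) (if c then 1 else 0)) (binomial_pmf m p))"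
    using assms by (simp add: binomial_pmf_Suc map_pmf_def)
  then show ?thesis using assms
    by (simp, subst pmf_expectation_bind[of UNIV])
       (auto simp: UNIV_bool set_pmf_binomial_eq split: if_splits)
qed

text \<open>Negating the bias negates the law of each sign. \<open>F\<close> is arbitrary in the
  induction because the recursion shifts its argument.\<close>

lemma expectation_walk_pmf_uminus:
  fixes F :: "int \<Rightarrow> real"
  assumes "\<bar>b\<bar> \<le> 1"
  shows "measure_pmf.expectation (walk_pmf k (- b)) F =
         measure_pmf.expectation (walk_pmf k b) (\<lambda>v. F (- v))"
proof (induction k arbitrary: F)
  case (Suc k)
  show ?case using assms by (simp add: expectation_walk_pmf_Suc Suc.IH del: add_uminus_conv_diff uminus_add_conv_diff)
qed (simp add: walk_pmf_0)

lemma expectation_walk_pmf_mono: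
  fixes F G :: "int \<Rightarrow> real"
  assumes "\<And>v. F v \<le> G v"
  shows "measure_pmf.expectation (walk_pmf k b) F \<le> measure_pmf.expectation (walk_pmf k b) G"
  using assms by (intro integral_mono integrable_measure_pmf_finite finite_set_pmf_walk)

text \<open>Stochastic dominance: the induction hypothesis changes the law of the shorter walk, and
  then moving mass \<open>b\<close> from the downward to the upward step can only increase the
  expectation of a monotone function.\<close>

lemma expectation_walk_pmf_mono_bias:
  fixes F :: "int \<Rightarrow> real"
  assumes "mono F" "0 \<le> b" "b \<le> 1"
  shows "measure_pmf.expectation (walk_pmf k (- b)) F \<le> measure_pmf.expectation (walk_pmf k b) F"
  using assms(1)
proof (induction k arbitrary: F)
  case (Suc k)
  let ?E = "\<lambda>c s. measure_pmf.expectation (walk_pmf k c) (\<lambda>v. F (s + v))"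
  have le: "?E (- b) s \<le> ?E b s" for s
    using Suc.prems by (intro Suc.IH) (auto simp: mono_def)
  have up: "?E b (- 1) \<le> ?E b 1"
    using Suc.prems by (intro expectation_walk_pmf_mono) (auto simp: mono_def)
  have "measure_pmf.expectation (walk_pmf (Suc k) (- b)) F =
      (1 - b) / 2 * ?E (- b) 1 + (1 + b) / 2 * ?E (- b) (- 1)"
    using assms by (subst expectation_walk_pmf_Suc) auto
  also have "\<dots> \<le> (1 - b) / 2 * ?E b 1 + (1 + b) / 2 * ?E b (- 1)"
    using assms le[of 1] le[of "- 1"] by (intro add_mono mult_left_mono) simp_all
  also have "\<dots> = (1 + b) / 2 * ?E b 1 + (1 - b) / 2 * ?E b (- 1) - b * (?E b 1 - ?E b (- 1))"
    by (simp add: field_simps)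
  also have "\<dots> \<le> (1 + b) / 2 * ?E b 1 + (1 - b) / 2 * ?E b (- 1)"
    using up assms by simp
  also have "\<dots> = measure_pmf.expectation (walk_pmf (Suc k) b) F"
    using assms by (subst expectation_walk_pmf_Suc) auto
  finally show ?case .
qed (simp add: walk_pmf_0)

text \<open>By symmetry a negative value is as likely as a positive one under \<open>- b\<close>, so
  the mean sign is the difference inside \<open>sep\<close>. By dominance this has the sign of
  \<open>b\<close>, so the factor \<open>b\<close> removes the absolute value.\<close>

lemma sep_eq_expectation_sgn:
  assumes "\<bar>b\<bar> \<le> 1"
  shows "b * measure_pmf.expectation (walk_pmf k b) (\<lambda>v. of_int (sgn v)) = \<bar>b\<bar> * sep k \<bar>b\<bar>"
proof -
  let ?P = "\<lambda>c. measure_pmf.prob (walk_pmf k c) {v. v > 0}"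
  have P: "?P c = measure_pmf.expectation (walk_pmf k c) (indicator {v. v > 0})" for c
    by simp
  have E: "measure_pmf.expectation (walk_pmf k c) (\<lambda>v. of_int (sgn v) :: real) = ?P c - ?P (- c)"
    if "\<bar>c\<bar> \<le> 1" for c
  proof -
    have "measure_pmf.expectation (walk_pmf k c) (\<lambda>v. of_int (sgn v) :: real) =
        measure_pmf.expectation (walk_pmf k c)
          (\<lambda>v. indicator {v. v > 0} v - indicator {v. v > 0} (- v))"
      by (intro Bochner_Integration.integral_cong) (auto simp: sgn_if indicator_def)
    also have "\<dots> = measure_pmf.expectation (walk_pmf k c) (indicator {v. v > 0}) -
        measure_pmf.expectation (walk_pmf k c) (\<lambda>v. indicator {v. v > 0} (- v))"
      by (intro Bochner_Integration.integral_diff integrable_measure_pmf_finite finite_set_pmf_walk)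
    also have "measure_pmf.expectation (walk_pmf k c) (\<lambda>v. indicator {v. v > 0} (- v) :: real) =
        measure_pmf.expectation (walk_pmf k (- c)) (indicator {v. v > 0})"
      by (rule expectation_walk_pmf_uminus[OF that, symmetric])
    finally show ?thesis by (simp only: P)
  qed
  have mono: "?P (- c) \<le> ?P c" if "0 \<le> c" "c \<le> 1" for c
    unfolding P using that
    by (intro expectation_walk_pmf_mono_bias) (auto simp: mono_def indicator_def)
  show ?thesis
  proof (cases "0 \<le> b")
    case True
    then show ?thesis using assms E[of b] mono[of b] by (simp add: sep_def)
  next
    case False
    then show ?thesis using assms E[of b] mono[of "- b"] by (simp add: sep_def right_diff_distrib)
  qed
qed

text \<open>Turns a summand of \<open>bayes_sum\<close> into the expected excess risk at a point of
  bias \<open>b\<close> when the sign of the walk is predicted, a tie counting as mean prediction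
  0.\<close>

lemma mult_bayes_eq:
  assumes "\<bar>b\<bar> \<le> 1"
  shows "\<bar>b\<bar> * bayes k \<bar>b\<bar> =
    (\<bar>b\<bar> - b * measure_pmf.expectation (walk_pmf k b) (\<lambda>v. of_int (sgn v))) / 2"
  using sep_eq_expectation_sgn[OF assms] by (simp add: bayes_def field_simps)

section \<open>The law of the vote\<close>

text \<open>For parameters in \<open>params d\<close>, the probability of a single example under
  \<open>dist_of d p \<beta>\<close>; the product \<open>sample_wt\<close> is the likelihood of a
  sample.\<close>

definition wt :: "(nat \<Rightarrow> real) \<Rightarrow> (nat \<Rightarrow> real) \<Rightarrow> nat \<times> int \<Rightarrow> real" where
  "wt p \<beta> e = p (fst e) * (1 / 2 + of_int (snd e) * \<beta> (fst e) / 2)"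

definition sample_wt :: "nat \<Rightarrow> (nat \<Rightarrow> real) \<Rightarrow> (nat \<Rightarrow> real) \<Rightarrow> (nat \<Rightarrow> nat \<times> int) \<Rightarrow> real" where
  "sample_wt m p \<beta> z = (\<Prod>i=1..m. wt p \<beta> (z i))"

lemma paramsD:
  assumes "(p, \<beta>) \<in> params d" "x \<in> {1..d}"
  shows "0 \<le> p x" "p x \<le> 1" "\<bar>\<beta> x\<bar> \<le> 1"
  using assms PiE_mem[of p "{1..d}" "\<lambda>_. {0..1}" x] PiE_mem[of \<beta> "{1..d}" "\<lambda>_. {-1..1}" x]
  by (auto simp: params_def)

lemma params_sum: "(p, \<beta>) \<in> params d \<Longrightarrow> (\<Sum>x=1..d. p x) = 1"
  by (simp add: params_def)

lemma finite_examples: "finite (examples d)"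
  by (simp add: examples_def)

lemma finite_samples: "finite (samples d m)"
  by (simp add: samples_def finite_PiE finite_examples)

lemma finite_hypotheses: "finite (hypotheses d)"
  by (simp add: hypotheses_def finite_PiE)

lemma wt_nonneg:
  assumes "(p, \<beta>) \<in> params d" "e \<in> examples d"
  shows "0 \<le> wt p \<beta> e"
  using assms paramsD[OF assms(1), of "fst e"]
  by (auto simp: wt_def examples_def intro!: mult_nonneg_nonneg)

lemma sum_examples: "(\<Sum>e\<in>examples d. f e) = (\<Sum>x=1..d. f (x, 1) + f (x, - 1))"
  unfolding examples_def by (subst sum.cartesian_product') (simp add: add.commute)

lemma sum_samples_Suc:
  "(\<Sum>z\<in>samples d (Suc m). f z) = (\<Sum>e\<in>examples d. \<Sum>z\<in>samples d m. f (z(Suc m := e)))"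
proof -
  have "{1..Suc m} = insert (Suc m) {1..m}" by auto
  then have "samples d (Suc m) = (\<lambda>(e, z). z(Suc m := e)) ` (examples d \<times> samples d m)"
    by (simp add: samples_def PiE_insert_eq)
  moreover have "inj_on (\<lambda>(e, z). z(Suc m := e)) (examples d \<times> samples d m)"
    unfolding samples_def by (rule inj_combinator) simp
  ultimately show ?thesis
    by (simp add: sum.reindex sum.cartesian_product case_prod_unfold)
qed

text \<open>Each example hits \<open>x\<close> with probability \<open>p x\<close> and then adds a
  sign of bias \<open>\<beta> x\<close>; otherwise it leaves the vote unchanged. Splitting off the
  last example reproduces the binomial and the walk recursion together.\<close>

lemma sum_sample_wt_vote:
  fixes F :: "int \<Rightarrow> real"
  assumes "(p, \<beta>) \<in> params d" "x \<in> {1..d}"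
  shows "(\<Sum>z\<in>samples d m. sample_wt m p \<beta> z * F (vote m z x)) =
    measure_pmf.expectation (binomial_pmf m (p x))
      (\<lambda>k. measure_pmf.expectation (walk_pmf k (\<beta> x)) F)"
proof (induction m arbitrary: F)
  case 0
  show ?case using paramsD[OF assms(1) assms(2)]
    by (simp add: samples_def sample_wt_def vote_def binomial_pmf_0 walk_pmf_0)
next
  case (Suc m)
  let ?S = "\<lambda>F. \<Sum>z\<in>samples d m. sample_wt m p \<beta> z * F (vote m z x)"
  let ?E = "\<lambda>F. measure_pmf.expectation (binomial_pmf m (p x))
      (\<lambda>k. measure_pmf.expectation (walk_pmf k (\<beta> x)) F)"
  have W: "sample_wt (Suc m) p \<beta> (z(Suc m := e)) = wt p \<beta> e * sample_wt m p \<beta> z" for z e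
  proof -
    have "(\<Prod>i=1..m. wt p \<beta> ((z(Suc m := e)) i)) = (\<Prod>i=1..m. wt p \<beta> (z i))"
      by (intro prod.cong) auto
    then show ?thesis by (simp add: sample_wt_def)
  qed
  have V: "vote (Suc m) (z(Suc m := e)) x = snd e * of_bool (fst e = x) + vote m z x" for z e
  proof -
    have "(\<Sum>i=1..m. snd ((z(Suc m := e)) i) * of_bool (fst ((z(Suc m := e)) i) = x)) =
        (\<Sum>i=1..m. snd (z i) * of_bool (fst (z i) = x))"
      by (intro sum.cong) auto
    then show ?thesis by (simp add: vote_def)
  qed
  have "(\<Sum>z\<in>samples d (Suc m). sample_wt (Suc m) p \<beta> z * F (vote (Suc m) z x)) =
      (\<Sum>e\<in>examples d. wt p \<beta> e * ?S (\<lambda>v. F (snd e * of_bool (fst e = x) + v)))"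
    by (simp only: sum_samples_Suc W V sum_distrib_left mult.assoc)
  also have "\<dots> = (\<Sum>a=1..d. wt p \<beta> (a, 1) * ?S (\<lambda>v. F (of_bool (a = x) + v)) +
      wt p \<beta> (a, - 1) * ?S (\<lambda>v. F (- of_bool (a = x) + v)))"
    by (simp add: sum_examples)
  also have "\<dots> = wt p \<beta> (x, 1) * ?S (\<lambda>v. F (1 + v)) + wt p \<beta> (x, - 1) * ?S (\<lambda>v. F (- 1 + v)) +
      (\<Sum>a\<in>{1..d} - {x}. wt p \<beta> (a, 1) * ?S (\<lambda>v. F (of_bool (a = x) + v)) +
      wt p \<beta> (a, - 1) * ?S (\<lambda>v. F (- of_bool (a = x) + v)))"
    using assms(2) by (subst sum.remove[of _ x]) auto
  \<comment> \<open>The two labels at a point \<open>a\<close> other than \<open>x\<close> have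
    total mass \<open>p a\<close>; over all such points these masses add up to
    \<open>1 - p x\<close>.\<close>
  also have "(\<Sum>a\<in>{1..d} - {x}. wt p \<beta> (a, 1) * ?S (\<lambda>v. F (of_bool (a = x) + v)) +
      wt p \<beta> (a, - 1) * ?S (\<lambda>v. F (- of_bool (a = x) + v))) = (\<Sum>a\<in>{1..d} - {x}. p a * ?S F)"
    by (intro sum.cong refl) (auto simp: wt_def field_simps)
  also have "\<dots> = (1 - p x) * ?S F"
    using params_sum[OF assms(1)] assms(2) by (simp add: sum_diff1 flip: sum_distrib_right)
  also have "wt p \<beta> (x, 1) * ?S (\<lambda>v. F (1 + v)) + wt p \<beta> (x, - 1) * ?S (\<lambda>v. F (- 1 + v)) =
     p x * ((1 + \<beta> x) / 2 * ?S (\<lambda>v. F (1 + v)) + (1 - \<beta> x) / 2 * ?S (\<lambda>v. F (- 1 + v)))"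
    by (simp add: wt_def field_simps)
  also have "\<dots> + (1 - p x) * ?S F =
     p x * ((1 + \<beta> x) / 2 * ?E (\<lambda>v. F (1 + v)) + (1 - \<beta> x) / 2 * ?E (\<lambda>v. F (- 1 + v))) +
     (1 - p x) * ?E F"
   
    by (simp only: Suc.IH[of F] Suc.IH[of "\<lambda>v. F (1 + v)"] Suc.IH[of "\<lambda>v. F (- 1 + v)"])
  also have "(1 + \<beta> x) / 2 * ?E (\<lambda>v. F (1 + v)) + (1 - \<beta> x) / 2 * ?E (\<lambda>v. F (- 1 + v)) =
     measure_pmf.expectation (binomial_pmf m (p x))
      (\<lambda>k. measure_pmf.expectation (walk_pmf (Suc k) (\<beta> x)) F)"
  proof -
    have fin: "finite (set_pmf (binomial_pmf m (p x)))"
      using paramsD[OF assms(1) assms(2)] by (simp add: set_pmf_binomial_eq)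
    show ?thesis using paramsD[OF assms(1) assms(2)]
      by (simp add: expectation_walk_pmf_Suc
          Bochner_Integration.integral_add[OF integrable_measure_pmf_finite[OF fin] integrable_measure_pmf_finite[OF fin]])
  qed
  finally show ?case
    using paramsD[OF assms(1) assms(2)] by (simp add: expectation_binomial_pmf_Suc)
qed

section \<open>Reversing the labels at one point\<close>

text \<open>An involution on the samples that keeps the occurrences of \<open>x\<close> in place but
  negates the vote there; it serves to cancel ties.\<close>

definition flip_labels :: "nat \<Rightarrow> nat \<Rightarrow> (nat \<Rightarrow> nat \<times> int) \<Rightarrow> nat \<Rightarrow> nat \<times> int" where
  "flip_labels m x z =
     (\<lambda>i\<in>{1..m}. (fst (z i), if fst (z i) = x then - snd (z i) else snd (z i)))"

lemma flip_labels_samples: "z \<in> samples d m \<Longrightarrow> flip_labels m x z \<in> samples d m"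
  by (force simp: samples_def flip_labels_def examples_def PiE_iff mem_Times_iff)

lemma flip_labels_flip_labels: "z \<in> samples d m \<Longrightarrow> flip_labels m x (flip_labels m x z) = z"
  by (force simp: samples_def flip_labels_def PiE_iff extensional_def fun_eq_iff)

lemma sum_flip_labels:
  "(\<Sum>z\<in>samples d m. f (flip_labels m x z)) = (\<Sum>z\<in>samples d m. f z)"
  by (rule sum.reindex_bij_witness[of _ "flip_labels m x" "flip_labels m x"])
     (auto simp: flip_labels_samples flip_labels_flip_labels)

lemma vote_flip_labels: "vote m (flip_labels m x z) x = - vote m z x"
  by (auto simp: vote_def flip_labels_def sum_negf[symmetric] intro!: sum.cong)

lemma occ_flip_labels: "occ m (flip_labels m x z) x = occ m z x"
  by (auto simp: occ_def flip_labels_def intro!: sum.cong)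

lemma first_occ_flip_labels: "first_occ m (flip_labels m x z) x = first_occ m z x"
  by (auto simp: first_occ_def flip_labels_def intro!: arg_cong[where f = Min])

lemma first_occ_mem:
  assumes "occ m z x \<noteq> 0"
  shows "first_occ m z x \<in> {1..m}" "fst (z (first_occ m z x)) = x"
proof -
  have "{i \<in> {1..m}. fst (z i) = x} \<noteq> {}"
    using assms by (auto simp: occ_def)
  then show "first_occ m z x \<in> {1..m}" "fst (z (first_occ m z x)) = x"
    using Min_in[of "{i \<in> {1..m}. fst (z i) = x}"] by (auto simp: first_occ_def)
qed

text \<open>A weight depends on a label only through its product with the bias.\<close>

lemma sample_wt_flip_labels:
  "sample_wt m p \<beta> (flip_labels m x z) = sample_wt m p (\<beta>(x := - \<beta> x)) z"
  by (auto simp: sample_wt_def flip_labels_def wt_def intro!: prod.cong)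

text \<open>With \<open>P\<close> positive and \<open>N\<close> negative labels the likelihood is
  \<open>s ^ P * t ^ N\<close>, and reversing the bias swaps \<open>s\<close> and \<open>t\<close>.
  The product form of the second claim covers all signs of \<open>b\<close> and of the vote at
  once.\<close>

lemma likelihood_flip:
  fixes y :: "'a \<Rightarrow> int" and b :: real
  assumes I: "finite I" and y: "\<And>i. i \<in> I \<Longrightarrow> y i \<in> {- 1, 1}" and b: "\<bar>b\<bar> \<le> 1"
  defines "g \<equiv> \<lambda>c. \<Prod>i\<in>I. 1 / 2 + of_int (y i) * c / 2"
  shows "(\<Sum>i\<in>I. y i) = 0 \<Longrightarrow> g (- b) = g b"
    and "0 \<le> b * (g b - g (- b)) * of_int (sgn (\<Sum>i\<in>I. y i))"
proof -
  define P N where "P = card {i\<in>I. y i = 1}" and "N = card {i\<in>I. y i = - 1}"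
  have "g c = ((1 + c) / 2) ^ P * ((1 - c) / 2) ^ N \<and> (\<Sum>i\<in>I. y i) = int P - int N" for c
    using I y unfolding g_def P_def N_def
  proof (induction I rule: finite_induct)
    case (insert i I)
    have "{j \<in> insert i I. y j = s} = (if y i = s then insert i {j\<in>I. y j = s} else {j\<in>I. y j = s})" for s
      by auto
    moreover have "y i \<in> {- 1, 1}" using insert.prems by simp
    ultimately show ?case using insert
      by (auto simp: field_simps)
  qed simp
  then have g: "g c = ((1 + c) / 2) ^ P * ((1 - c) / 2) ^ N"
    and v: "(\<Sum>i\<in>I. y i) = int P - int N" for c by auto
  show "(\<Sum>i\<in>I. y i) = 0 \<Longrightarrow> g (- b) = g b"
    by (simp add: g v)
  define s t where "s = (1 + b) / 2" and "t = (1 - b) / 2"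
  have st: "0 \<le> s" "0 \<le> t" and bst: "b = s - t" using b by (auto simp: s_def t_def field_simps)
  \<comment> \<open>Powers are monotone on nonnegative numbers, so both factors have the same
    sign.\<close>
  have *: "0 \<le> (s - t) * (s ^ n - t ^ n)" for n
  proof (cases "s \<le> t")
    case True
    then show ?thesis using st by (intro mult_nonpos_nonpos) (auto intro: power_mono)
  next
    case False
    then show ?thesis using st by (intro mult_nonneg_nonneg) (auto intro: power_mono)
  qed
  have gb: "g b = s ^ P * t ^ N" "g (- b) = t ^ P * s ^ N"
    by (simp_all add: g s_def t_def)
  consider "P = N" | "P > N" | "P < N" by linarith
  then show "0 \<le> b * (g b - g (- b)) * of_int (sgn (\<Sum>i\<in>I. y i))"
  proof cases
    case 1
    then show ?thesis by (simp add: v)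
  next
    case 2
    then obtain n where n: "P = N + n" by (metis less_imp_add_positive)
    \<comment> \<open>The smaller exponent is pulled out as a common nonnegative factor, leaving a
      difference of \<open>n\<close>-th powers.\<close>
    have "b * (g b - g (- b)) * of_int (sgn (\<Sum>i\<in>I. y i)) = (s ^ N * t ^ N) * ((s - t) * (s ^ n - t ^ n))"
      unfolding v gb unfolding bst using 2 by (simp add: n power_add algebra_simps)
    then show ?thesis using st * by simp
  next
    case 3
    then obtain n where n: "N = P + n" by (metis less_imp_add_positive)
    have "b * (g b - g (- b)) * of_int (sgn (\<Sum>i\<in>I. y i)) = (s ^ P * t ^ P) * ((s - t) * (s ^ n - t ^ n))"
      unfolding v gb unfolding bst using 3 by (simp add: n power_add algebra_simps)
    then show ?thesis using st * by simp
  qed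
qed

text \<open>Only the occurrences of \<open>x\<close> see the bias there. They contribute
  \<open>g\<close>, to which \<open>likelihood_flip\<close> applies; the powers of
  \<open>p x\<close> and all other factors form the nonnegative constant \<open>K\<close>.\<close>

lemma sample_wt_sign_flip:
  assumes "(p, \<beta>) \<in> params d" "x \<in> {1..d}" "z \<in> samples d m"
  shows "vote m z x = 0 \<Longrightarrow> sample_wt m p (\<beta>(x := - \<beta> x)) z = sample_wt m p \<beta> z"
    and "0 \<le> \<beta> x * (sample_wt m p \<beta> z - sample_wt m p (\<beta>(x := - \<beta> x)) z) * of_int (sgn (vote m z x))"
proof -
  define I J where "I = {i\<in>{1..m}. fst (z i) = x}" and "J = {i\<in>{1..m}. fst (z i) \<noteq> x}"
  define K where "K = p x ^ card I * (\<Prod>i\<in>J. wt p \<beta> (z i))"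
  define g where "g = (\<lambda>c::real. \<Prod>i\<in>I. 1 / 2 + of_int (snd (z i)) * c / 2)"
  have z: "z i \<in> examples d" if "i \<in> {1..m}" for i
    using assms(3) that by (auto simp: samples_def)
  have IJ: "{1..m} = I \<union> J" "I \<inter> J = {}" "finite I" "finite J"
    by (auto simp: I_def J_def)
  have W: "sample_wt m p (\<beta>(x := c)) z = K * g c" for c
  proof -
    have "sample_wt m p (\<beta>(x := c)) z =
        (\<Prod>i\<in>I. wt p (\<beta>(x := c)) (z i)) * (\<Prod>i\<in>J. wt p (\<beta>(x := c)) (z i))"
      using IJ by (simp add: sample_wt_def prod.union_disjoint)
    also have "(\<Prod>i\<in>I. wt p (\<beta>(x := c)) (z i)) = p x ^ card I * g c"
      unfolding g_def prod_constant[symmetric] prod.distrib[symmetric]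
      by (intro prod.cong) (auto simp: I_def wt_def)
    also have "(\<Prod>i\<in>J. wt p (\<beta>(x := c)) (z i)) = (\<Prod>i\<in>J. wt p \<beta> (z i))"
      by (intro prod.cong) (auto simp: J_def wt_def)
    finally show ?thesis by (simp only: K_def mult_ac)
  qed
  have W': "sample_wt m p \<beta> z = K * g (\<beta> x)"
    using W[of "\<beta> x"] by simp
  have K: "0 \<le> K"
    unfolding K_def using paramsD(1)[OF assms(1,2)] z
    by (intro mult_nonneg_nonneg zero_le_power prod_nonneg wt_nonneg[OF assms(1)]) (auto simp: J_def)
  have V: "vote m z x = (\<Sum>i\<in>I. snd (z i))"
    unfolding vote_def I_def by (intro sum.mono_neutral_cong_right) auto
  have y: "snd (z i) \<in> {- 1, 1}" if "i \<in> I" for i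
    using z[of i] that by (auto simp: I_def examples_def)
  have g: "vote m z x = 0 \<Longrightarrow> g (- \<beta> x) = g (\<beta> x)"
      "0 \<le> \<beta> x * (g (\<beta> x) - g (- \<beta> x)) * of_int (sgn (vote m z x))"
    unfolding g_def V using IJ(3) y paramsD(3)[OF assms(1,2)]
    by (intro likelihood_flip; simp)+
  show "vote m z x = 0 \<Longrightarrow> sample_wt m p (\<beta>(x := - \<beta> x)) z = sample_wt m p \<beta> z"
    unfolding W W' using g(1) by simp
  have "\<beta> x * (K * g (\<beta> x) - K * g (- \<beta> x)) * of_int (sgn (vote m z x)) =
      K * (\<beta> x * (g (\<beta> x) - g (- \<beta> x)) * of_int (sgn (vote m z x)))"
    by (simp add: algebra_simps)
  then show "0 \<le> \<beta> x * (sample_wt m p \<beta> z - sample_wt m p (\<beta>(x := - \<beta> x)) z) * of_int (sgn (vote m z x))"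
    unfolding W W' using mult_nonneg_nonneg[OF K g(2)] by (simp only:)
qed

text \<open>The excess risk is affine in the predicted labels, so an algorithm enters its risk only
  through these means.\<close>

definition mean_label ::
  "((nat \<Rightarrow> nat \<times> int) \<Rightarrow> real \<Rightarrow> nat \<Rightarrow> int) \<Rightarrow> (nat \<Rightarrow> nat \<times> int) \<Rightarrow> nat \<Rightarrow> real" where
  "mean_label L z x = (\<integral>u. of_int (L z u x) \<partial>seed)"

lemma space_seed: "space seed = {- 1..1}"
  by (simp add: seed_def space_restrict_space)

lemma sets_seed: "sets seed = sets (restrict_space borel {- 1..1})"
  by (simp add: seed_def sets_restrict_space)

text \<open>Both halves of the seed interval have length 1 out of 2, with or without the point
  0.\<close>

lemma integral_sgn1_seed: "(\<integral>u. of_int (sgn1 u) \<partial>seed) = (0 :: real)"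
proof -
  have sp: "{- 1..1} \<inter> space lborel \<in> sets (lborel :: real measure)" by simp
  have s: "{0..1} \<in> sets seed" "{- 1..<0} \<in> sets seed"
    by (auto simp: sets_seed sets_restrict_space_iff)
  interpret prob_space seed by (rule prob_space_seed)
  have m: "measure seed A = 1 / 2"
    if "A \<in> sets seed" "A \<subseteq> {- 1..1}" "emeasure lborel A = 1" for A
  proof -
    have "emeasure seed A = emeasure (restrict_space lborel {- 1..1}) ({- 1..1} \<inter> A) /
        emeasure (restrict_space lborel {- 1..1}) {- 1..1::real}"
      using that unfolding seed_def
      by (subst emeasure_uniform_measure) (auto simp: sets_restrict_space_iff)
    also have "{- 1..1} \<inter> A = A" using that by auto
    also have "emeasure (restrict_space lborel {- 1..1}) A = 1"
      using that by (simp add: emeasure_restrict_space)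
    also have "emeasure (restrict_space lborel {- 1..1}) {- 1..1::real} = ennreal 2"
      by (subst emeasure_restrict_space) auto
    also have "1 / ennreal 2 = ennreal (1 / 2)"
      by (metis divide_ennreal ennreal_1 zero_le_one zero_less_numeral)
    finally show ?thesis by (rule measure_eq_emeasure_eq_ennreal[rotated]) simp
  qed
  have "(\<integral>u. of_int (sgn1 u) \<partial>seed) = (\<integral>u. indicator {0..1} u - indicator {- 1..<0} u \<partial>seed :: real)"
    by (intro Bochner_Integration.integral_cong refl) (auto simp: space_seed sgn1_def indicator_def)
  also have "\<dots> = measure seed {0..1} - measure seed {- 1..<0}"
    using s by (subst Bochner_Integration.integral_diff) (auto simp: integrable_indicator_iff less_top[symmetric])
  also have "\<dots> = 0"
    using s by (subst (1 2) m) auto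
  finally show ?thesis .
qed

text \<open>The seed is consulted only at points missing from the sample, where its fair sign
  averages to 0.\<close>

lemma mean_label_L_ERM:
  assumes "x \<in> {1..d}"
  shows "mean_label (L_ERM d m) z x =
    (if vote m z x \<noteq> 0 then of_int (sgn (vote m z x))
     else if occ m z x \<noteq> 0 then of_int (snd (z (first_occ m z x))) else 0)"
proof -
  interpret prob_space seed by (rule prob_space_seed)
  show ?thesis using assms
    by (auto simp: mean_label_def L_ERM_def prob_space integral_sgn1_seed) (auto simp: sgn1_def sgn_if)
qed

text \<open>
  The contributions of samples with tied votes cancel: reversing the labels at \<open>x\<close>
  preserves the weight of such a sample and negates the first label.
\<close>

lemma sum_mean_label_L_ERM:
  assumes "(p, \<beta>) \<in> params d" "x \<in> {1..d}"
  shows "(\<Sum>z\<in>samples d m. sample_wt m p \<beta> z * mean_label (L_ERM d m) z x) =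
         (\<Sum>z\<in>samples d m. sample_wt m p \<beta> z * of_int (sgn (vote m z x)))"
proof -
  \<comment> \<open>This deviation vanishes unless the vote is tied. At a tie it is the first label
    at \<open>x\<close>, which the reversal negates, or 0 if \<open>x\<close> does not
    occur.\<close>
  define r where "r z = mean_label (L_ERM d m) z x - of_int (sgn (vote m z x))" for z
  have "sample_wt m p \<beta> (flip_labels m x z) * r (flip_labels m x z) = - (sample_wt m p \<beta> z * r z)"
    if z: "z \<in> samples d m" for z
  proof (cases "vote m z x = 0")
    case True
    then have "sample_wt m p \<beta> (flip_labels m x z) = sample_wt m p \<beta> z"
      using sample_wt_sign_flip(1)[OF assms z] by (simp add: sample_wt_flip_labels)
    moreover have "r (flip_labels m x z) = - r z"
      using True first_occ_mem[of m z x] assms(2)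
      by (auto simp: r_def mean_label_L_ERM vote_flip_labels occ_flip_labels first_occ_flip_labels)
         (auto simp: flip_labels_def)
    ultimately show ?thesis by simp
  qed (use assms in \<open>simp add: r_def mean_label_L_ERM vote_flip_labels\<close>)
  \<comment> \<open>The reversal permutes the samples, so the sum equals its own negative.\<close>
  then have "(\<Sum>z\<in>samples d m. sample_wt m p \<beta> z * r z) = - (\<Sum>z\<in>samples d m. sample_wt m p \<beta> z * r z)"
    using sum_flip_labels[of "\<lambda>z. sample_wt m p \<beta> z * r z" m x d] by (simp add: sum_negf)
  then show ?thesis by (simp add: r_def right_diff_distrib sum_subtractf)
qed

section \<open>Risk as a finite sum\<close>

lemma hypothesesD: "h \<in> hypotheses d \<Longrightarrow> x \<in> {1..d} \<Longrightarrow> h x = - 1 \<or> h x = 1"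
  by (auto simp: hypotheses_def PiE_iff)

lemma measure_dist_of:
  assumes "(p, \<beta>) \<in> params d" "A \<subseteq> examples d"
  shows "measure (dist_of d p \<beta>) A = (\<Sum>e\<in>A. wt p \<beta> e)"
proof -
  have "emeasure (dist_of d p \<beta>) A = (\<Sum>e\<in>A. ennreal (wt p \<beta> e))"
    using assms(2) by (simp add: dist_of_def emeasure_point_measure_finite finite_examples wt_def case_prod_unfold)
  also have "\<dots> = ennreal (\<Sum>e\<in>A. wt p \<beta> e)"
    using assms wt_nonneg by (intro sum_ennreal) auto
  finally show ?thesis
    using assms wt_nonneg by (intro measure_eq_emeasure_eq_ennreal sum_nonneg) auto
qed

lemma space_dist_of: "space (dist_of d p \<beta>) = examples d"
  by (simp add: dist_of_def space_point_measure)

text \<open>Of the two labels at \<open>x\<close>, only \<open>- h x\<close> is an error.\<close>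

lemma err_dist_of:
  assumes "(p, \<beta>) \<in> params d" "h \<in> hypotheses d"
  shows "err h (dist_of d p \<beta>) = (\<Sum>x=1..d. p x * (1 - of_int (h x) * \<beta> x) / 2)"
proof -
  have "err h (dist_of d p \<beta>) = (\<Sum>e | e \<in> examples d \<and> h (fst e) \<noteq> snd e. wt p \<beta> e)"
    unfolding err_def space_dist_of using assms(1)
    by (subst measure_dist_of) (auto intro!: sum.cong)
  also have "\<dots> = (\<Sum>e\<in>examples d. if h (fst e) \<noteq> snd e then wt p \<beta> e else 0)"
    by (subst sum.inter_filter[symmetric]) (auto simp: finite_examples)
  also have "\<dots> = (\<Sum>x=1..d. p x * (1 - of_int (h x) * \<beta> x) / 2)"
    unfolding sum_examples
  proof (intro sum.cong refl)
    fix x assume "x \<in> {1..d}"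
    then show "(if h (fst (x, 1)) \<noteq> snd (x, 1) then wt p \<beta> (x, 1) else 0) +
        (if h (fst (x, - 1)) \<noteq> snd (x, - 1) then wt p \<beta> (x, - 1) else 0) =
        p x * (1 - of_int (h x) * \<beta> x) / 2"
      using hypothesesD[OF assms(2), of x] by (auto simp: wt_def field_simps)
  qed
  finally show ?thesis .
qed

lemma excess_risk_dist_of:
  assumes "(p, \<beta>) \<in> params d" "h \<in> hypotheses d"
  shows "excess_risk d h (dist_of d p \<beta>) = (\<Sum>x=1..d. p x * (\<bar>\<beta> x\<bar> - of_int (h x) * \<beta> x) / 2)"
proof -
  \<comment> \<open>The Bayes classifier; where \<open>\<beta> x = 0\<close> both labels have the
    same error.\<close>
  define opt where "opt = (\<lambda>x\<in>{1..d}. sgn1 (\<beta> x))"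
  have opt: "opt \<in> hypotheses d"
    by (auto simp: opt_def hypotheses_def sgn1_def)
  have "Min ((\<lambda>g. err g (dist_of d p \<beta>)) ` hypotheses d) = (\<Sum>x=1..d. p x * (1 - \<bar>\<beta> x\<bar>) / 2)"
  proof (rule Min_eqI)
    have "err opt (dist_of d p \<beta>) = (\<Sum>x=1..d. p x * (1 - \<bar>\<beta> x\<bar>) / 2)"
      unfolding err_dist_of[OF assms(1) opt] by (intro sum.cong) (auto simp: opt_def sgn1_def)
    then show "(\<Sum>x=1..d. p x * (1 - \<bar>\<beta> x\<bar>) / 2) \<in> (\<lambda>g. err g (dist_of d p \<beta>)) ` hypotheses d"
      using opt by (metis imageI)
  next
    fix e assume "e \<in> (\<lambda>g. err g (dist_of d p \<beta>)) ` hypotheses d"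
    then obtain g where g: "g \<in> hypotheses d" "e = err g (dist_of d p \<beta>)" by auto
    have "p x * (1 - \<bar>\<beta> x\<bar>) \<le> p x * (1 - of_int (g x) * \<beta> x)" if "x \<in> {1..d}" for x
      using hypothesesD[OF g(1) that] paramsD[OF assms(1) that] by (intro mult_left_mono) auto
    then show "(\<Sum>x=1..d. p x * (1 - \<bar>\<beta> x\<bar>) / 2) \<le> e"
      unfolding g(2) err_dist_of[OF assms(1) g(1)] by (intro sum_mono divide_right_mono) auto
  qed (simp add: finite_hypotheses)
  then show ?thesis
    unfolding excess_risk_def err_dist_of[OF assms]
    by (simp add: sum_subtractf[symmetric] diff_divide_distrib[symmetric] right_diff_distrib)
qed

context
  fixes d m :: nat and L :: "(nat \<Rightarrow> nat \<times> int) \<Rightarrow> real \<Rightarrow> nat \<Rightarrow> int"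
  assumes L: "L \<in> rand_algs d m"
begin

lemma rand_algs_measurable: "z \<in> samples d m \<Longrightarrow> L z \<in> seed \<rightarrow>\<^sub>M count_space (hypotheses d)"
  using L measurable_cong_sets[OF sets_seed refl] by (auto simp: rand_algs_def)

lemma rand_algs_hypotheses: "z \<in> samples d m \<Longrightarrow> u \<in> space seed \<Longrightarrow> L z u \<in> hypotheses d"
  using measurable_space[OF rand_algs_measurable] by auto

text \<open>There are finitely many hypotheses, so \<open>f\<close> is bounded on them by the sum of
  its absolute values.\<close>

lemma integrable_rand_algs:
  fixes f :: "(nat \<Rightarrow> int) \<Rightarrow> real"
  assumes "z \<in> samples d m"
  shows "integrable seed (\<lambda>u. f (L z u))"
proof -
  interpret prob_space seed by (rule prob_space_seed)
  have "norm (f (L z u)) \<le> (\<Sum>h\<in>hypotheses d. norm (f h))" if "u \<in> space seed" for u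
    using that assms by (intro member_le_sum rand_algs_hypotheses) (auto simp: finite_hypotheses)
  moreover have "(\<lambda>u. f (L z u)) \<in> borel_measurable seed"
    using rand_algs_measurable[OF assms] by (rule measurable_compose) simp
  ultimately show ?thesis
    by (intro integrable_const_bound) auto
qed

lemma mean_label_bounds:
  assumes "z \<in> samples d m" "x \<in> {1..d}"
  shows "- 1 \<le> mean_label L z x" "mean_label L z x \<le> 1"
proof -
  interpret prob_space seed by (rule prob_space_seed)
  have "L z u x = - 1 \<or> L z u x = 1" if "u \<in> space seed" for u
    using hypothesesD[OF rand_algs_hypotheses[OF assms(1) that] assms(2)] .
  then have "- 1 \<le> real_of_int (L z u x) \<and> real_of_int (L z u x) \<le> 1" if "u \<in> space seed" for u
    using that by fastforce
  then show "- 1 \<le> mean_label L z x" "mean_label L z x \<le> 1"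
    unfolding mean_label_def using integrable_rand_algs[OF assms(1), of "\<lambda>h. of_int (h x)"]
    by (intro integral_ge_const integral_le_const; auto)+
qed

text \<open>The sample space is finite, so the integrand is a finite sum of products of the
  indicator of a sample and a function of the seed, and Fubini applies to each. Joint measurability
  follows in this way from measurability in the seed alone.\<close>

lemma risk_eq_sum:
  assumes D: "D \<in> distributions d"
  shows "risk d m L D =
    (\<Sum>z\<in>samples d m. (\<Prod>i=1..m. measure D {z i}) * (\<integral>u. excess_risk d (L z u) D \<partial>seed))"
proof -
  have sD: "sets D = Pow (examples d)" using D by (simp add: distributions_def)
  have spD: "space D = examples d"
    using sD by (metis Pow_top sets.sets_into_space sets.top Pow_iff subset_antisym)
  interpret D: prob_space D using D by (simp add: distributions_def)
  interpret S: prob_space seed by (rule prob_space_seed)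
  interpret P: finite_product_prob_space "\<lambda>_. D" "{1..m}" by unfold_locales auto
  let ?P = "\<Pi>\<^sub>M i\<in>{1..m}. D"
  interpret PP: pair_prob_space ?P seed by unfold_locales
  have spP: "space ?P = samples d m" by (simp add: space_PiM samples_def spD)
  \<comment> \<open>As a box, a singleton is measurable and its measure is the product of the masses
    of its coordinates.\<close>
  have single: "{z} = (\<Pi>\<^sub>E i\<in>{1..m}. {z i})" if "z \<in> samples d m" for z
    using that by (subst PiE_singleton) (auto simp: samples_def PiE_iff)
  have zi: "z i \<in> examples d" if "z \<in> samples d m" "i \<in> {1..m}" for z i
    using that by (auto simp: samples_def)
  have sets: "{z} \<in> sets ?P" if "z \<in> samples d m" for z
    unfolding single[OF that] using zi[OF that] by (intro sets_PiM_I_finite) (auto simp: sD)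
  have meas: "measure ?P {z} = (\<Prod>i=1..m. measure D {z i})" if "z \<in> samples d m" for z
    unfolding single[OF that] using zi[OF that] by (subst P.finite_measure_PiM_emb) (auto simp: sD)
  let ?f = "\<lambda>z u. excess_risk d (L z u) D"
  have int: "integrable (?P \<Otimes>\<^sub>M seed) (\<lambda>(z', u). indicator {z} z' * ?f z u)"
    if z: "z \<in> samples d m" for z
  proof (rule PP.integrable_const_bound)
    have [measurable]: "{z} \<in> sets ?P" "?f z \<in> borel_measurable seed"
      using sets[OF z] integrable_rand_algs[OF z] by auto
    show "(\<lambda>(z', u). indicator {z} z' * ?f z u) \<in> borel_measurable (?P \<Otimes>\<^sub>M seed)"
      by measurable
    have "norm (?f z u) \<le> (\<Sum>h\<in>hypotheses d. norm (excess_risk d h D))" if "u \<in> space seed" for u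
      using that z by (intro member_le_sum rand_algs_hypotheses) (auto simp: finite_hypotheses)
    then show "AE w in ?P \<Otimes>\<^sub>M seed. norm (case w of (z', u) \<Rightarrow> indicator {z} z' * ?f z u)
        \<le> (\<Sum>h\<in>hypotheses d. norm (excess_risk d h D))"
      by (intro AE_I2) (auto simp: space_pair_measure indicator_def intro!: sum_nonneg)
  qed
  have "risk d m L D = (\<integral>w. (\<Sum>z\<in>samples d m. case w of (z', u) \<Rightarrow> indicator {z} z' * ?f z u) \<partial>(?P \<Otimes>\<^sub>M seed))"
    unfolding risk_def
  proof (intro Bochner_Integration.integral_cong refl)
    fix w assume "w \<in> space (?P \<Otimes>\<^sub>M seed)"
    then obtain z u where w: "w = (z, u)" "z \<in> samples d m"
      unfolding space_pair_measure spP by blast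
    have "(\<Sum>z'\<in>samples d m. indicator {z'} z * ?f z' u) = (\<Sum>z'\<in>{z}. indicator {z'} z * ?f z' u)"
      using w by (intro sum.mono_neutral_right) (auto simp: finite_samples)
    then show "(case w of (z, u) \<Rightarrow> ?f z u) =
        (\<Sum>z\<in>samples d m. case w of (z', u) \<Rightarrow> indicator {z} z' * ?f z u)"
      by (simp add: w)
  qed
  also have "\<dots> = (\<Sum>z\<in>samples d m. \<integral>(z', u). indicator {z} z' * ?f z u \<partial>(?P \<Otimes>\<^sub>M seed))"
    using int by (intro Bochner_Integration.integral_sum) auto
  also have "\<dots> = (\<Sum>z\<in>samples d m. measure ?P {z} * (\<integral>u. ?f z u \<partial>seed))"
  proof (intro sum.cong refl)
    fix z assume z: "z \<in> samples d m"
    show "(\<integral>(z', u). indicator {z} z' * ?f z u \<partial>(?P \<Otimes>\<^sub>M seed)) = measure ?P {z} * (\<integral>u. ?f z u \<partial>seed)"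
      using sets[OF z] z by (subst PP.integral_fst'[OF int[OF z], symmetric]) (simp add: spP)
  qed
  finally show ?thesis by (simp only: meas cong: sum.cong)
qed

text \<open>The excess risk is a sum over points, affine in each label, so the averages over the
  seed and the sample pass to the labels.\<close>

lemma risk_dist_of:
  assumes pb: "(p, \<beta>) \<in> params d"
  shows "risk d m L (dist_of d p \<beta>) =
    (\<Sum>x=1..d. p x * (\<bar>\<beta> x\<bar> - \<beta> x * (\<Sum>z\<in>samples d m. sample_wt m p \<beta> z * mean_label L z x)) / 2)"
proof -
  interpret S: prob_space seed by (rule prob_space_seed)
  \<comment> \<open>The law of the vote for a constant function; it needs some point
    \<open>x\<close> to refer to.\<close>
  have one: "(\<Sum>z\<in>samples d m. sample_wt m p \<beta> z) = 1" if "x \<in> {1..d}" for x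
    using sum_sample_wt_vote[OF pb that, of m "\<lambda>_. 1"] by simp
  have W: "(\<Prod>i=1..m. measure (dist_of d p \<beta>) {z i}) = sample_wt m p \<beta> z" if "z \<in> samples d m" for z
    unfolding sample_wt_def using that
    by (intro prod.cong refl) (subst measure_dist_of[OF pb], auto simp: samples_def)
  have E: "(\<integral>u. excess_risk d (L z u) (dist_of d p \<beta>) \<partial>seed) =
      (\<Sum>x=1..d. p x * (\<bar>\<beta> x\<bar> - \<beta> x * mean_label L z x) / 2)" if z: "z \<in> samples d m" for z
  proof -
    have "(\<integral>u. excess_risk d (L z u) (dist_of d p \<beta>) \<partial>seed) =
        (\<integral>u. (\<Sum>x=1..d. p x * (\<bar>\<beta> x\<bar> - \<beta> x * of_int (L z u x)) / 2) \<partial>seed)"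
      by (intro Bochner_Integration.integral_cong refl)
         (simp add: excess_risk_dist_of[OF pb] rand_algs_hypotheses[OF z] mult.commute)
    also have "\<dots> = (\<Sum>x=1..d. \<integral>u. p x * (\<bar>\<beta> x\<bar> - \<beta> x * of_int (L z u x)) / 2 \<partial>seed)"
      by (intro Bochner_Integration.integral_sum integrable_rand_algs[OF z])
    also have "\<dots> = (\<Sum>x=1..d. p x * (\<bar>\<beta> x\<bar> - \<beta> x * mean_label L z x) / 2)"
      using integrable_rand_algs[OF z, of "\<lambda>h. of_int (h _)"]
      by (simp add: mean_label_def Bochner_Integration.integral_diff S.prob_space)
    finally show ?thesis .
  qed
  have "risk d m L (dist_of d p \<beta>) =
      (\<Sum>z\<in>samples d m. sample_wt m p \<beta> z * (\<Sum>x=1..d. p x * (\<bar>\<beta> x\<bar> - \<beta> x * mean_label L z x) / 2))"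
    unfolding risk_eq_sum[OF dist_of_distributions[OF pb]] using W E by (intro sum.cong) auto
  also have "\<dots> = (\<Sum>x=1..d. \<Sum>z\<in>samples d m. sample_wt m p \<beta> z * (p x * (\<bar>\<beta> x\<bar> - \<beta> x * mean_label L z x) / 2))"
    by (subst sum.swap) (simp add: sum_distrib_left)
  also have "\<dots> = (\<Sum>x=1..d. p x * (\<bar>\<beta> x\<bar> - \<beta> x * (\<Sum>z\<in>samples d m. sample_wt m p \<beta> z * mean_label L z x)) / 2)"
  proof (intro sum.cong refl)
    fix x assume x: "x \<in> {1..d}"
    have "(\<Sum>z\<in>samples d m. sample_wt m p \<beta> z * (p x * (\<bar>\<beta> x\<bar> - \<beta> x * mean_label L z x) / 2)) =
        (\<Sum>z\<in>samples d m. p x * \<bar>\<beta> x\<bar> / 2 * sample_wt m p \<beta> z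
           - p x * \<beta> x / 2 * (sample_wt m p \<beta> z * mean_label L z x))"
      by (intro sum.cong refl) (simp add: field_simps)
    also have "\<dots> = p x * \<bar>\<beta> x\<bar> / 2 * (\<Sum>z\<in>samples d m. sample_wt m p \<beta> z)
        - p x * \<beta> x / 2 * (\<Sum>z\<in>samples d m. sample_wt m p \<beta> z * mean_label L z x)"
      by (simp only: sum_subtractf sum_distrib_left)
    finally show "(\<Sum>z\<in>samples d m. sample_wt m p \<beta> z * (p x * (\<bar>\<beta> x\<bar> - \<beta> x * mean_label L z x) / 2)) =
        p x * (\<bar>\<beta> x\<bar> - \<beta> x * (\<Sum>z\<in>samples d m. sample_wt m p \<beta> z * mean_label L z x)) / 2"
      by (simp add: one[OF x] field_simps)
  qed
  finally show ?thesis .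
qed

end

section \<open>Optimality of empirical risk minimization\<close>

text \<open>Ties cancel, so each mean label may be replaced by the sign of the vote; the law of the
  vote and \<open>mult_bayes_eq\<close> then give the Bayes terms.\<close>

lemma risk_L_ERM:
  assumes "(p, \<beta>) \<in> params d"
  shows "risk d m (L_ERM d m) (dist_of d p \<beta>) = bayes_sum m d p \<beta>"
  unfolding risk_dist_of[OF L_ERM_rand_algs assms] bayes_sum_def
proof (intro sum.cong refl)
  fix x assume x: "x \<in> {1..d}"
  note px = paramsD[OF assms x]
  let ?N = "binomial_pmf m (p x)"
  let ?s = "\<lambda>k. measure_pmf.expectation (walk_pmf k (\<beta> x)) (\<lambda>v. of_int (sgn v) :: real)"
  have fin: "finite (set_pmf ?N)" using px by (simp add: set_pmf_binomial_eq)
  have "\<bar>\<beta> x\<bar> * measure_pmf.expectation ?N (\<lambda>k. bayes k \<bar>\<beta> x\<bar>) =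
      measure_pmf.expectation ?N (\<lambda>k. (\<bar>\<beta> x\<bar> - \<beta> x * ?s k) / 2)"
    by (simp add: mult_bayes_eq[OF px(3), symmetric])
  also have "\<dots> = (\<bar>\<beta> x\<bar> - \<beta> x * measure_pmf.expectation ?N ?s) / 2"
    by (simp add: Bochner_Integration.integral_diff integrable_measure_pmf_finite[OF fin])
  finally show "p x * (\<bar>\<beta> x\<bar> - \<beta> x *
      (\<Sum>z\<in>samples d m. sample_wt m p \<beta> z * mean_label (L_ERM d m) z x)) / 2 =
      p x * \<bar>\<beta> x\<bar> * measure_pmf.expectation ?N (\<lambda>k. bayes k \<bar>\<beta> x\<bar>)"
    by (simp add: sum_mean_label_L_ERM[OF assms x] sum_sample_wt_vote[OF assms x, of _ "\<lambda>v. of_int (sgn v)"]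
        mult.assoc)
qed

text \<open>Where \<open>p x = 0\<close>, the quotient defining \<open>\<beta> x\<close> is 0, which is as good as any value.\<close>

lemma distribution_eq_dist_of:
  assumes "D \<in> distributions d"
  obtains p \<beta> where "(p, \<beta>) \<in> params d" "D = dist_of d p \<beta>"
proof -
  interpret prob_space D using assms by (simp add: distributions_def)
  have sD: "sets D = Pow (examples d)" using assms by (simp add: distributions_def)
  have spD: "space D = examples d"
    using sD by (metis Pow_top sets.sets_into_space sets.top Pow_iff subset_antisym)
  define w where "w x y = measure D {(x, y)}" for x :: nat and y :: int
  \<comment> \<open>\<open>p\<close> is the marginal law on the points, and \<open>\<beta> x\<close>
    is the conditional mean of the label given \<open>x\<close>.\<close>
  define p where "p = (\<lambda>x\<in>{1..d}. w x 1 + w x (- 1))"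
  define \<beta> where "\<beta> = (\<lambda>x\<in>{1..d}. (w x 1 - w x (- 1)) / p x)"
  have w: "0 \<le> w x y" for x y by (simp add: w_def)
  have "(\<Sum>e\<in>examples d. measure D {e}) = 1"
    using finite_measure_eq_sum_singleton[OF finite_examples[of d]] prob_space by (simp add: sD spD)
  then have sum: "(\<Sum>x=1..d. p x) = 1"
    unfolding sum_examples by (simp add: p_def w_def)
  have pnn: "0 \<le> p x" if "x \<in> {1..d}" for x using that w by (simp add: p_def)
  have p1: "p x \<le> 1" if "x \<in> {1..d}" for x
    unfolding sum[symmetric] using that pnn by (intro member_le_sum) auto
  have \<beta>1: "\<bar>\<beta> x\<bar> \<le> 1" if "x \<in> {1..d}" for x
  proof -
    have "\<bar>w x 1 - w x (- 1)\<bar> \<le> p x"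
      using that w[of x 1] w[of x "- 1"] by (simp add: p_def abs_le_iff)
    then show ?thesis using that pnn[OF that] by (auto simp: \<beta>_def divide_le_eq_1)
  qed
  have "p \<in> {1..d} \<rightarrow>\<^sub>E {0..1}"
    using pnn p1 by (intro PiE_I) (simp, auto simp: p_def)
  moreover have "\<beta> \<in> {1..d} \<rightarrow>\<^sub>E {- 1..1}"
    using \<beta>1 by (intro PiE_I) (force simp: abs_le_iff, auto simp: \<beta>_def)
  ultimately have pb: "(p, \<beta>) \<in> params d"
    using sum by (simp add: params_def)
  have "measure D {e} = wt p \<beta> e" if e: "e \<in> examples d" for e
  proof -
    obtain x y where e': "e = (x, y)" "x \<in> {1..d}" "y = 1 \<or> y = - 1"
      using e by (auto simp: examples_def)
    show ?thesis
    proof (cases "p x = 0")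
      case True
      then have "w x 1 = 0" "w x (- 1) = 0"
        using e'(2) w[of x 1] w[of x "- 1"] by (auto simp: p_def)
      then show ?thesis using e'(1,3) True by (auto simp: wt_def w_def)
    next
      case False
      then have "p x * \<beta> x = w x 1 - w x (- 1)" "p x = w x 1 + w x (- 1)"
        using e'(2) by (auto simp: \<beta>_def p_def)
      then have "wt p \<beta> (x, 1) = w x 1" "wt p \<beta> (x, - 1) = w x (- 1)"
        by (simp_all add: wt_def distrib_left field_simps)
      then show ?thesis using e'(1,3) by (auto simp: w_def)
    qed
  qed
  then have "emeasure D {e} = emeasure (dist_of d p \<beta>) {e}" if "e \<in> examples d" for e
    using that measure_dist_of[OF pb, of "{e}"] dist_of_distributions[OF pb]
      finite_measure.emeasure_eq_measure[of "dist_of d p \<beta>"]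
    by (simp add: emeasure_eq_measure distributions_def prob_space_def)
  then have "D = dist_of d p \<beta>"
    using sD dist_of_distributions[OF pb] finite_examples
    by (intro measure_eqI_finite[of _ "examples d"]) (auto simp: distributions_def)
  with pb show ?thesis by (rule that)
qed

lemma distributions_eq: "distributions d = (\<lambda>(p, \<beta>). dist_of d p \<beta>) ` params d"
proof
  show "distributions d \<subseteq> (\<lambda>(p, \<beta>). dist_of d p \<beta>) ` params d"
    by (auto elim!: distribution_eq_dist_of)
qed (auto intro: dist_of_distributions)

text \<open>\<open>S\<close> contains each sign pattern of \<open>\<beta>\<close> once, a zero of
  \<open>\<beta>\<close> allowing a single value. Summing over it separates the comparison into one
  for each point and sample.\<close>

lemma sum_risk_L_ERM_le:
  assumes L: "L \<in> rand_algs d m" and pb: "(p, \<beta>) \<in> params d"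
  defines "S \<equiv> \<Pi>\<^sub>E x\<in>{1..d}. {\<beta> x, - \<beta> x}"
  shows "(\<Sum>\<gamma>\<in>S. risk d m (L_ERM d m) (dist_of d p \<gamma>)) \<le> (\<Sum>\<gamma>\<in>S. risk d m L (dist_of d p \<gamma>))"
proof -
  have S: "(p, \<gamma>) \<in> params d" if "\<gamma> \<in> S" for \<gamma>
  proof -
    have "\<gamma> x \<in> {- 1..1}" if x: "x \<in> {1..d}" for x
      using PiE_mem[OF \<open>\<gamma> \<in> S\<close>[unfolded S_def] x] paramsD(3)[OF pb x] by auto
    then show ?thesis using pb that by (auto simp: params_def S_def PiE_iff)
  qed
  \<comment> \<open>The part of the summed risk that depends on the mean prediction \<open>l\<close>
    at \<open>x\<close> for the sample \<open>z\<close>. It enters with a negative sign, so larger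
    is better.\<close>
  define T where "T x z l = (\<Sum>\<gamma>\<in>S. \<gamma> x * sample_wt m p \<gamma> z) * l" for x z and l :: real
  have T: "T x z (mean_label L z x) \<le> T x z (mean_label (L_ERM d m) z x)"
    if x: "x \<in> {1..d}" and z: "z \<in> samples d m" for x z
  proof -
    define c where "c = (\<Sum>\<gamma>\<in>S. \<gamma> x * sample_wt m p \<gamma> z)"
    define c' where "c' = (\<Sum>\<gamma>\<in>S. \<gamma> x * (sample_wt m p \<gamma> z - sample_wt m p (\<gamma>(x := - \<gamma> x)) z))"
    have mem: "\<gamma>(x := - \<gamma> x) \<in> S" if "\<gamma> \<in> S" for \<gamma>
      using that x by (force simp: S_def PiE_iff extensional_def)
    \<comment> \<open>Reversing the sign at \<open>x\<close> is an involution of \<open>S\<close>,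
      so twice the coefficient \<open>c\<close> is a sum of biases times likelihood
      differences.\<close>
    have "(\<Sum>\<gamma>\<in>S. - \<gamma> x * sample_wt m p (\<gamma>(x := - \<gamma> x)) z) = c"
      unfolding c_def using mem
      by (intro sum.reindex_bij_witness[of _ "\<lambda>\<gamma>. \<gamma>(x := - \<gamma> x)" "\<lambda>\<gamma>. \<gamma>(x := - \<gamma> x)"]) auto
    then have c: "2 * c = c'"
      by (simp add: c'_def right_diff_distrib sum_subtractf sum_negf c_def)
    have "0 \<le> c' * of_int (sgn (vote m z x))"
      unfolding c'_def sum_distrib_right using S x z by (intro sum_nonneg sample_wt_sign_flip(2))
    then have sgn: "0 \<le> c * of_int (sgn (vote m z x))"
      by (simp flip: c)
    have zero: "c = 0" if "vote m z x = 0"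
    proof -
      have "c' = 0"
        unfolding c'_def using sample_wt_sign_flip(1)[OF S x z that] by simp
      with c show ?thesis by simp
    qed
    note b = mean_label_bounds[OF L z x]
    \<comment> \<open>A linear function on \<open>[-1, 1]\<close> is largest at the endpoint given
      by the sign of its coefficient, and a nonzero \<open>c\<close> has the sign of the
      vote.\<close>
    consider "vote m z x = 0" | "vote m z x > 0" | "vote m z x < 0" by linarith
    then have "c * mean_label L z x \<le> c * mean_label (L_ERM d m) z x"
    proof cases
      case 1
      then show ?thesis using zero by simp
    next
      case 2
      then have "c * mean_label L z x \<le> c * 1"
        using sgn b by (intro mult_left_mono) auto
      then show ?thesis using 2 x by (simp add: mean_label_L_ERM)
    next
      case 3
      then have "c * mean_label L z x \<le> c * - 1"
        using sgn b by (intro mult_left_mono_neg) auto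
      then show ?thesis using 3 x by (simp add: mean_label_L_ERM)
    qed
    then show ?thesis by (simp add: T_def c_def)
  qed
  have risk: "(\<Sum>\<gamma>\<in>S. risk d m A (dist_of d p \<gamma>)) =
      (\<Sum>x=1..d. p x * ((\<Sum>\<gamma>\<in>S. \<bar>\<gamma> x\<bar>) - (\<Sum>z\<in>samples d m. T x z (mean_label A z x))) / 2)"
    if "A \<in> rand_algs d m" for A
  proof -
    have "(\<Sum>\<gamma>\<in>S. risk d m A (dist_of d p \<gamma>)) = (\<Sum>\<gamma>\<in>S. \<Sum>x=1..d. p x *
        (\<bar>\<gamma> x\<bar> - \<gamma> x * (\<Sum>z\<in>samples d m. sample_wt m p \<gamma> z * mean_label A z x)) / 2)"
      using risk_dist_of[OF that S] by (intro sum.cong) auto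
    also have "\<dots> = (\<Sum>x=1..d. \<Sum>\<gamma>\<in>S. p x *
        (\<bar>\<gamma> x\<bar> - \<gamma> x * (\<Sum>z\<in>samples d m. sample_wt m p \<gamma> z * mean_label A z x)) / 2)"
      by (rule sum.swap)
    also have "\<dots> = (\<Sum>x=1..d. p x * ((\<Sum>\<gamma>\<in>S. \<bar>\<gamma> x\<bar>) -
        (\<Sum>\<gamma>\<in>S. \<Sum>z\<in>samples d m. \<gamma> x * sample_wt m p \<gamma> z * mean_label A z x)) / 2)"
      by (simp add: sum_distrib_left sum_subtractf mult.assoc flip: sum_divide_distrib sum_distrib_left)
    also have "\<dots> = (\<Sum>x=1..d. p x * ((\<Sum>\<gamma>\<in>S. \<bar>\<gamma> x\<bar>) - (\<Sum>z\<in>samples d m. T x z (mean_label A z x))) / 2)"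
      by (subst sum.swap) (simp add: T_def sum_distrib_right)
    finally show ?thesis .
  qed
  show ?thesis
    unfolding risk[OF L] risk[OF L_ERM_rand_algs]
    using T paramsD(1)[OF pb] by (intro sum_mono divide_right_mono mult_left_mono diff_left_mono) auto
qed

lemma risk_le_SUP:
  assumes "L \<in> rand_algs d m" "D \<in> distributions d"
  shows "risk d m L D \<le> (SUP D\<in>distributions d. risk d m L D)"
  using assms risk_bounds(2)[OF assms(1)] by (intro cSUP_upper bdd_aboveI2[where M = 1]) auto

text \<open>The risk of \<open>L_ERM d m\<close> is constant on \<open>S\<close>, hence equal to its
  mean there, which is at most the mean for \<open>L\<close> and so at most the worst case for
  \<open>L\<close>.\<close>

lemma risk_L_ERM_le_SUP:
  assumes L: "L \<in> rand_algs d m" and pb: "(p, \<beta>) \<in> params d"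
  shows "risk d m (L_ERM d m) (dist_of d p \<beta>) \<le> (SUP D\<in>distributions d. risk d m L D)"
proof -
  define S where "S = (\<Pi>\<^sub>E x\<in>{1..d}. {\<beta> x, - \<beta> x})"
  have fin: "finite S" by (simp add: S_def finite_PiE)
  \<comment> \<open>\<open>S\<close> is nonempty, so the factor \<open>card S\<close> can be
    cancelled at the end.\<close>
  have "restrict \<beta> {1..d} \<in> S" by (auto simp: S_def)
  then have card: "0 < card S" using fin by (auto simp: card_gt_0_iff)
  have S: "(p, \<gamma>) \<in> params d" "\<And>x. x \<in> {1..d} \<Longrightarrow> \<bar>\<gamma> x\<bar> = \<bar>\<beta> x\<bar>" if "\<gamma> \<in> S" for \<gamma>
  proof -
    show eq: "\<bar>\<gamma> x\<bar> = \<bar>\<beta> x\<bar>" if "x \<in> {1..d}" for x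
      using PiE_mem[OF \<open>\<gamma> \<in> S\<close>[unfolded S_def] that] by auto
    show "(p, \<gamma>) \<in> params d"
      using pb that eq paramsD(3)[OF pb] by (auto simp: params_def S_def PiE_iff abs_le_iff)
  qed
  have "card S * risk d m (L_ERM d m) (dist_of d p \<beta>) = (\<Sum>\<gamma>\<in>S. risk d m (L_ERM d m) (dist_of d p \<gamma>))"
    using S by (simp add: risk_L_ERM pb bayes_sum_def)
  also have "\<dots> \<le> (\<Sum>\<gamma>\<in>S. risk d m L (dist_of d p \<gamma>))"
    unfolding S_def by (rule sum_risk_L_ERM_le[OF L pb])
  also have "\<dots> \<le> card S * (SUP D\<in>distributions d. risk d m L D)"
    using S by (intro sum_bounded_above risk_le_SUP[OF L] dist_of_distributions) auto
  finally show ?thesis using card by simp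
qed

lemma params_nonempty:
  assumes "d \<ge> 1"
  shows "params d \<noteq> {}"
proof -
  \<comment> \<open>All mass at the point 1, which lies in \<open>{1..d}\<close> because
    \<open>d \<ge> 1\<close>.\<close>
  have "(\<lambda>x\<in>{1..d}. of_bool (x = 1), \<lambda>x\<in>{1..d}. 0) \<in> params d"
    using assms by (auto simp: params_def sum.delta' of_bool_def)
  then show ?thesis by blast
qed

theorem theorem2p2:
  fixes d m :: nat
  assumes "d \<ge> 1"
  shows "(INF L\<in>rand_algs d m. SUP D\<in>distributions d. risk d m L D)
           = (SUP D\<in>distributions d. risk d m (L_ERM d m) D)
       \<and> (SUP D\<in>distributions d. risk d m (L_ERM d m) D) = B m d
       \<and> (\<forall>(p, \<beta>)\<in>params d.
            risk d m (L_ERM d m) (dist_of d p \<beta>) = bayes_sum m d p \<beta>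
          \<and> (\<forall>\<beta>'. (p, \<beta>') \<in> params d \<longrightarrow> (\<forall>x\<in>{1..d}. \<bar>\<beta>' x\<bar> = \<bar>\<beta> x\<bar>) \<longrightarrow>
               risk d m (L_ERM d m) (dist_of d p \<beta>') = risk d m (L_ERM d m) (dist_of d p \<beta>)))"
proof (intro conjI)
  have ne: "distributions d \<noteq> {}"
    using params_nonempty[OF assms] by (simp add: distributions_eq)
  \<comment> \<open>The worst case of \<open>L_ERM d m\<close> is a lower bound for all worst cases
    and is one of them, so the infimum is a minimum.\<close>
  have "(SUP D\<in>distributions d. risk d m (L_ERM d m) D) \<le> (SUP D\<in>distributions d. risk d m L D)"
    if "L \<in> rand_algs d m" for L
    using ne risk_L_ERM_le_SUP[OF that] by (intro cSUP_least) (auto simp: distributions_eq)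
  then show "(INF L\<in>rand_algs d m. SUP D\<in>distributions d. risk d m L D)
      = (SUP D\<in>distributions d. risk d m (L_ERM d m) D)"
    using L_ERM_rand_algs by (intro cInf_eq_minimum) auto
  \<comment> \<open>Every distribution is some \<open>dist_of d p \<beta>\<close>, so both suprema
    run over \<open>params d\<close> with equal terms.\<close>
  show "(SUP D\<in>distributions d. risk d m (L_ERM d m) D) = B m d"
    unfolding B_def distributions_eq image_image
    by (intro SUP_cong refl) (auto simp: risk_L_ERM)
  show "\<forall>(p, \<beta>)\<in>params d.
      risk d m (L_ERM d m) (dist_of d p \<beta>) = bayes_sum m d p \<beta>
    \<and> (\<forall>\<beta>'. (p, \<beta>') \<in> params d \<longrightarrow> (\<forall>x\<in>{1..d}. \<bar>\<beta>' x\<bar> = \<bar>\<beta> x\<bar>) \<longrightarrow>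
         risk d m (L_ERM d m) (dist_of d p \<beta>') = risk d m (L_ERM d m) (dist_of d p \<beta>))"
    by (auto simp: risk_L_ERM bayes_sum_def)
qed

end
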